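(* Let $m \ge 2$ be an integer, $H \in (m-1,m)$ and $T \in (0,\infty)$, and let $B_{H,m}$ be an $m$-th order fractional Brownian motion with Hurst parameter $H$. Then the sequence $$2^{n} \sum_{k = 1}^{2^n}\left(B_{H,m}\Big(\frac{kT}{2^n}\Big) - B_{H,m}\Big(\frac{(k-1)T}{2^n}\Big)\right)^2$$ converges to some non-constant random variable in $L^p$ for all $p \in (1,\infty)$ as $n \to \infty$.
   Context: For an integer $m\ge 1$ and $H\in(m-1,m)$, an $m$-th order fractional Brownian motion $B_{H,m}=\{B_{H,m}(t),t\in[0,\infty)\}$ is a centered Gaussian process with covariance function $$G_{H,m}(s,t) = (-1)^m\frac{C_{H}^m}{2}\left(|t-s|^{2H} - \sum_{j = 0}^{m-1}(-1)^j\binom{2H}{j}\left(\Big(\frac{t}{s}\Big)^j s^{2H} + \Big(\frac{s}{t}\Big)^j t^{2H}\right)\right),$$ where $C_H^{m} = \big(\Gamma(2H+1)|\sin(\pi H)|\big)^{-1}$ (the superscript $m$ is an index, not a power), $\binom{2H}{j}$ is the generalized binomial coefficient, and $(t/s)^j s^{2H}$ is read as $t^j s^{2H-j}$ (so that the formula makes sense also when $s=0$ or $t=0$, with $0^0=1$). A random variable is non-constant if it is not almost surely equal to a constant. *)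

theory Defs
  imports "HOL-Probability.Probability"
begin

text \<open>
  A real random variable is Gaussian if it is normally distributed; as usual for Gaussian
  processes, the degenerate case of variance 0 (an almost surely constant variable) is included.
\<close>

definition gaussian_rv :: "'a measure \<Rightarrow> ('a \<Rightarrow> real) \<Rightarrow> bool" where
  "gaussian_rv M X \<longleftrightarrow>
     X \<in> borel_measurable M \<and>
     (\<exists>\<mu> \<sigma>. (\<sigma> > 0 \<and> distributed M lborel X (\<lambda>x. ennreal (normal_density \<mu> \<sigma> x))) \<or>
            (\<sigma> = 0 \<and> (AE \<omega> in M. X \<omega> = \<mu>)))"

text \<open>
  The finite-dimensional distributions are multivariate normal, i.e. every finite linear
  combination of the variables is Gaussian.
\<close>

definition gaussian_process :: "'a measure \<Rightarrow> 'i set \<Rightarrow> ('i \<Rightarrow> 'a \<Rightarrow> real) \<Rightarrow> bool" where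
  "gaussian_process M I X \<longleftrightarrow>
     prob_space M \<and>
     (\<forall>t\<in>I. X t \<in> borel_measurable M) \<and>
     (\<forall>J a. finite J \<longrightarrow> J \<subseteq> I \<longrightarrow> gaussian_rv M (\<lambda>\<omega>. \<Sum>t\<in>J. a t * X t \<omega>))"

definition covariance :: "'a measure \<Rightarrow> ('a \<Rightarrow> real) \<Rightarrow> ('a \<Rightarrow> real) \<Rightarrow> real" where
  "covariance M X Y =
     (LINT \<omega>|M. (X \<omega> - integral\<^sup>L M X) * (Y \<omega> - integral\<^sup>L M Y))"

definition fbm_const :: "real \<Rightarrow> real" where
  "fbm_const H = inverse (Gamma (2 * H + 1) * \<bar>sin (pi * H)\<bar>)"

text \<open>
  The products \<open>(t/s)\<^sup>j s\<^sup>2\<^sup>H\<close> are written \<open>t\<^sup>j s\<^bsup>2H-j\<^esup>\<close>. For \<open>m - 1 < H < m\<close> and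
  \<open>j < m\<close> the exponent \<open>2H - j\<close> is positive, so the convention \<open>0 powr a = 0\<close> gives the
  intended value at \<open>s = 0\<close>.
\<close>

definition fbm_cov :: "real \<Rightarrow> nat \<Rightarrow> real \<Rightarrow> real \<Rightarrow> real" where
  "fbm_cov H m s t =
     (-1) ^ m * (fbm_const H / 2) *
       (\<bar>t - s\<bar> powr (2 * H) -
        (\<Sum>j<m. (-1) ^ j * ((2 * H) gchoose j) *
           (t ^ j * s powr (2 * H - real j) + s ^ j * t powr (2 * H - real j))))"

definition fractional_brownian_motion ::
    "'a measure \<Rightarrow> real \<Rightarrow> nat \<Rightarrow> (real \<Rightarrow> 'a \<Rightarrow> real) \<Rightarrow> bool" where
  "fractional_brownian_motion M H m B \<longleftrightarrow>
     m \<ge> 1 \<and> real m - 1 < H \<and> H < real m \<and>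
     gaussian_process M {0..} B \<and>
     (\<forall>t\<ge>0. integral\<^sup>L M (B t) = 0) \<and>
     (\<forall>s\<ge>0. \<forall>t\<ge>0. covariance M (B s) (B t) = fbm_cov H m s t)"

definition in_Lp :: "'a measure \<Rightarrow> real \<Rightarrow> ('a \<Rightarrow> real) \<Rightarrow> bool" where
  "in_Lp M p X \<longleftrightarrow>
     X \<in> borel_measurable M \<and> integrable M (\<lambda>\<omega>. \<bar>X \<omega>\<bar> powr p)"

definition Lp_norm :: "'a measure \<Rightarrow> real \<Rightarrow> ('a \<Rightarrow> real) \<Rightarrow> real" where
  "Lp_norm M p X = (LINT \<omega>|M. \<bar>X \<omega>\<bar> powr p) powr (1 / p)"

definition converges_in_Lp ::
    "'a measure \<Rightarrow> real \<Rightarrow> (nat \<Rightarrow> 'a \<Rightarrow> real) \<Rightarrow> ('a \<Rightarrow> real) \<Rightarrow> bool" where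
  "converges_in_Lp M p X Y \<longleftrightarrow>
     (\<forall>n. in_Lp M p (X n)) \<and> in_Lp M p Y \<and>
     (\<lambda>n. Lp_norm M p (\<lambda>\<omega>. X n \<omega> - Y \<omega>)) \<longlonglongrightarrow> 0"

definition nonconstant_rv :: "'a measure \<Rightarrow> ('a \<Rightarrow> real) \<Rightarrow> bool" where
  "nonconstant_rv M Y \<longleftrightarrow> Y \<in> borel_measurable M \<and> \<not> (\<exists>c. AE \<omega> in M. Y \<omega> = c)"

end

theory Submission
  imports Defs
begin

text \<open>
  Since \<open>(x + y)\<^sup>2 \<le> 2 (x\<^sup>2 + y\<^sup>2)\<close>, halving the mesh never decreases the scaled quadratic
  variation, so it increases pointwise to a limit \<open>Y\<close>. As \<open>H > 1\<close>, the covariance gives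
  \<open>E (B t - B s)\<^sup>2 \<le> K (t - s)\<^sup>2\<close> on \<open>[0, T]\<close>; with the formula for even Gaussian moments and
  convexity of powers, every moment of the scaled variation is bounded uniformly in the mesh.
  Hence \<open>Y\<close> has all moments, and dominated convergence yields convergence in every \<open>L\<^sup>p\<close>.
  Finally \<open>Y \<ge> (B T - B 0)\<^sup>2\<close>, and \<open>B T - B 0\<close> is a nondegenerate Gaussian, hence unbounded.
\<close>

section \<open>Centered Gaussian variables: moments and unboundedness\<close>

lemma gaussian_rv_integrable:
  assumes "prob_space M" "gaussian_rv M X"
  shows "integrable M X"
proof -
  interpret prob_space M by fact
  have [measurable]: "X \<in> borel_measurable M"
    using assms(2) by (simp add: gaussian_rv_def)
  obtain \<mu> \<sigma> where "(\<sigma> > 0 \<and> distributed M lborel X (\<lambda>x. ennreal (normal_density \<mu> \<sigma> x))) \<or>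
      (\<sigma> = 0 \<and> (AE \<omega> in M. X \<omega> = \<mu>))"
    using assms(2) unfolding gaussian_rv_def by blast
  then show ?thesis
  proof (elim disjE conjE)
    assume \<sigma>: "\<sigma> > 0" and D: "distributed M lborel X (\<lambda>x. ennreal (normal_density \<mu> \<sigma> x))"
    show ?thesis
      by (rule distributed_integrable_var[OF D _ integrable_normal_moment_nz_1[OF \<sigma>]]) simp
  next
    assume "AE \<omega> in M. X \<omega> = \<mu>"
    then have "AE \<omega> in M. \<mu> = X \<omega>"
      by eventually_elim simp
    then show ?thesis
      by (intro integrable_cong_AE_imp[of M "\<lambda>_. \<mu>" X]) auto
  qed
qed

text \<open>The factor is the double factorial (2k - 1)!!. Expressing the moment through the
  variance instead of \<open>\<sigma>\<close> lets one formula cover the degenerate case as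
  well.\<close>

lemma centered_gaussian_moment:
  assumes "prob_space M" "gaussian_rv M X" and mean: "integral\<^sup>L M X = 0"
  shows "has_bochner_integral M (\<lambda>\<omega>. X \<omega> ^ (2 * k))
           (fact (2 * k) / (2 ^ k * fact k) * (LINT \<omega>|M. (X \<omega>)\<^sup>2) ^ k)"
proof -
  interpret prob_space M by fact
  have [measurable]: "X \<in> borel_measurable M"
    using assms(2) by (simp add: gaussian_rv_def)
  obtain \<mu> \<sigma> where "(\<sigma> > 0 \<and> distributed M lborel X (\<lambda>x. ennreal (normal_density \<mu> \<sigma> x))) \<or>
      (\<sigma> = 0 \<and> (AE \<omega> in M. X \<omega> = \<mu>))"
    using assms(2) unfolding gaussian_rv_def by blast
  then show ?thesis
  proof (elim disjE conjE)
    assume \<sigma>: "\<sigma> > 0" and D: "distributed M lborel X (\<lambda>x. ennreal (normal_density \<mu> \<sigma> x))"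
    have \<mu>: "\<mu> = 0"
      using normal_distributed_expectation[OF \<sigma> D] mean by simp
    have var: "(LINT \<omega>|M. (X \<omega>)\<^sup>2) = \<sigma>\<^sup>2"
      using normal_distributed_variance[OF \<sigma> D] mean by simp
    note moment = normal_moment_even[OF \<sigma>, of 0 k, simplified]
    have int: "integrable M (\<lambda>\<omega>. X \<omega> ^ (2 * k))"
      using distributed_integrable[OF D, of "\<lambda>x. x ^ (2 * k)"] integrable.intros[OF moment] \<mu>
      by simp
    have "(LINT \<omega>|M. X \<omega> ^ (2 * k)) = fact (2 * k) / ((2 / \<sigma>\<^sup>2) ^ k * fact k)"
      using distributed_integral[OF D, of "\<lambda>x. x ^ (2 * k)"]
        has_bochner_integral_integral_eq[OF moment] \<mu> by simp
    also have "\<dots> = fact (2 * k) / (2 ^ k * fact k) * (\<sigma>\<^sup>2) ^ k"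
      using \<sigma> by (simp add: power_divide)
    finally show ?thesis
      using int var by (simp add: has_bochner_integral_iff)
  next
    assume AE: "AE \<omega> in M. X \<omega> = \<mu>"
    have "integral\<^sup>L M X = (LINT \<omega>|M. \<mu>)"
      using AE by (intro integral_cong_AE) auto
    then have AE0: "AE \<omega> in M. X \<omega> = 0"
      using AE mean by (simp add: prob_space)
    \<comment> \<open>Since \<open>0 ^ 0 = 1\<close>, the value \<open>0 ^ n\<close> is also correct
      for \<open>n = 0\<close>, where it is the total mass of the probability space.\<close>
    have moment0: "has_bochner_integral M (\<lambda>\<omega>. X \<omega> ^ n) (0 ^ n)" for n
    proof -
      have "has_bochner_integral M (\<lambda>\<omega>. 0 ^ n :: real) (0 ^ n)"
        by (simp add: has_bochner_integral_iff prob_space)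
      then show ?thesis
        using AE0 by (subst has_bochner_integral_cong_AE[where g="\<lambda>_. 0 ^ n"]) auto
    qed
    have "(LINT \<omega>|M. (X \<omega>)\<^sup>2) = 0"
      using has_bochner_integral_integral_eq[OF moment0[of 2]] by simp
    then show ?thesis
      using moment0[of "2 * k"] by (cases k) auto
  qed
qed

text \<open>A nondegenerate normal density is positive everywhere, so an almost sure bound on
  \<open>X\<close> would transfer to Lebesgue-almost every real number. The nonzero variance rules
  out the degenerate case.\<close>

lemma centered_gaussian_unbounded:
  assumes "prob_space M" "gaussian_rv M X" and mean: "integral\<^sup>L M X = 0"
    and var: "(LINT \<omega>|M. (X \<omega>)\<^sup>2) \<noteq> 0"
  shows "\<not> (AE \<omega> in M. (X \<omega>)\<^sup>2 \<le> c)"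
proof
  assume bdd: "AE \<omega> in M. (X \<omega>)\<^sup>2 \<le> c"
  interpret prob_space M by fact
  have [measurable]: "X \<in> borel_measurable M"
    using assms(2) by (simp add: gaussian_rv_def)
  obtain \<mu> \<sigma> where "(\<sigma> > 0 \<and> distributed M lborel X (\<lambda>x. ennreal (normal_density \<mu> \<sigma> x))) \<or>
      (\<sigma> = 0 \<and> (AE \<omega> in M. X \<omega> = \<mu>))"
    using assms(2) unfolding gaussian_rv_def by blast
  then show False
  proof (elim disjE conjE)
    assume \<sigma>: "\<sigma> > 0" and D: "distributed M lborel X (\<lambda>x. ennreal (normal_density \<mu> \<sigma> x))"
    have "AE x in distr M lborel X. x\<^sup>2 \<le> c"
      using bdd by (subst AE_distr_iff) auto
    then have "AE x in lborel. 0 < ennreal (normal_density \<mu> \<sigma> x) \<longrightarrow> x\<^sup>2 \<le> c"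
      unfolding distributed_distr_eq_density[OF D] by (subst (asm) AE_density) auto
    then have "AE x in lborel. x\<^sup>2 \<le> c"
      using \<sigma> by (simp add: normal_density_pos)
    \<comment> \<open>Starting the interval at \<open>\<bar>c\<bar> + 1\<close> gives both
      \<open>x \<ge> 1\<close> and \<open>x > c\<close>, hence x * x \<ge> x > c; its length 1 makes
      it non-null.\<close>
    moreover have "\<not> x\<^sup>2 \<le> c" if "x \<in> {\<bar>c\<bar> + 1..\<bar>c\<bar> + 2}" for x :: real
    proof -
      have "x * 1 \<le> x * x"
        using that by (intro mult_left_mono) auto
      then show ?thesis
        using that by (auto simp: power2_eq_square)
    qed
    ultimately have "AE x in lborel. x \<notin> {\<bar>c\<bar> + 1..\<bar>c\<bar> + 2}"
      by (auto elim: eventually_mono)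
    then have "emeasure lborel {\<bar>c\<bar> + 1..\<bar>c\<bar> + 2} = 0"
      by (subst (asm) AE_iff_measurable[where N="{\<bar>c\<bar> + 1..\<bar>c\<bar> + 2}"]) auto
    then show False by simp
  next
    assume AE: "AE \<omega> in M. X \<omega> = \<mu>"
    have "integral\<^sup>L M X = (LINT \<omega>|M. \<mu>)"
      using AE by (intro integral_cong_AE) auto
    then have "AE \<omega> in M. X \<omega> = 0"
      using AE mean by (simp add: prob_space)
    then have "(LINT \<omega>|M. (X \<omega>)\<^sup>2) = (LINT \<omega>|M. 0)"
      by (intro integral_cong_AE) auto
    then show False using var by simp
  qed
qed

section \<open>From uniform moment bounds to convergence in L^p\<close>

text \<open>Jensen's inequality with equal weights 1/N for the power function, convex on the
  half-line. Working with averages keeps later moment bounds independent of the number of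
  summands.\<close>

lemma power_average_le:
  fixes x :: "nat \<Rightarrow> real"
  assumes "N > 0" "\<And>i. i < N \<Longrightarrow> x i \<ge> 0"
  shows "((\<Sum>i<N. x i) / N) ^ k \<le> (\<Sum>i<N. x i ^ k) / N"
proof -
  have "convex_on {0::real..} (\<lambda>x. x ^ k)"
    using convex_power_even[of k] convex_power_odd[of k]
    by (cases "even k") (auto intro: convex_on_subset)
  then have "(\<Sum>i<N. (1 / real N) *\<^sub>R x i) ^ k \<le> (\<Sum>i<N. (1 / real N) * x i ^ k)"
    using assms by (intro convex_on_sum[where C="{0..}" and f="\<lambda>x. x ^ k"]) auto
  then show ?thesis
    by (simp add: sum_divide_distrib)
qed

text \<open>Monotone convergence applied to each power \<open>V n \<omega> ^ k\<close> bounds all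
  moments of the limit, and the limit then dominates the whole sequence. Stating the bounds as
  nonnegative integrals makes finiteness part of the hypothesis.\<close>

lemma incseq_converges_in_Lp:
  fixes V :: "nat \<Rightarrow> 'a \<Rightarrow> real"
  assumes "prob_space M"
    and meas [measurable]: "\<And>n. V n \<in> borel_measurable M"
    and nonneg: "\<And>n \<omega>. V n \<omega> \<ge> 0"
    and mono: "\<And>\<omega>. incseq (\<lambda>n. V n \<omega>)"
    and bdd: "\<And>k::nat. \<exists>K. \<forall>n. (\<integral>\<^sup>+\<omega>. ennreal (V n \<omega> ^ k) \<partial>M) \<le> ennreal K"
  obtains Y where "Y \<in> borel_measurable M" "AE \<omega> in M. \<forall>n. V n \<omega> \<le> Y \<omega>"
    "\<And>p. p > 1 \<Longrightarrow> converges_in_Lp M p V Y"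
proof
  interpret prob_space M by fact
  \<comment> \<open>Defined at every point, which keeps \<open>Y\<close> measurable; where the
    sequence diverges the value is arbitrary, and this set turns out to be null.\<close>
  define Y where "Y \<omega> = lim (\<lambda>n. V n \<omega>)" for \<omega>
  show [measurable]: "Y \<in> borel_measurable M"
    unfolding Y_def by measurable
  have SUP_fin: "(\<integral>\<^sup>+\<omega>. (SUP n. ennreal (V n \<omega> ^ k)) \<partial>M) < \<infinity>" for k
  proof -
    obtain K where K: "\<And>n. (\<integral>\<^sup>+\<omega>. ennreal (V n \<omega> ^ k) \<partial>M) \<le> ennreal K"
      using bdd by blast
    have "(\<integral>\<^sup>+\<omega>. (SUP n. ennreal (V n \<omega> ^ k)) \<partial>M) = (SUP n. \<integral>\<^sup>+\<omega>. ennreal (V n \<omega> ^ k) \<partial>M)"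
      using mono nonneg
      by (intro nn_integral_monotone_convergence_SUP)
        (auto simp: incseq_def le_fun_def intro!: ennreal_leI power_mono)
    also have "\<dots> \<le> ennreal K"
      using K by (intro SUP_least)
    finally show ?thesis
      by (rule le_less_trans) simp
  qed
  \<comment> \<open>The first moment alone makes the supremum finite almost everywhere, and a
    bounded increasing sequence converges.\<close>
  have "AE \<omega> in M. (SUP n. ennreal (V n \<omega> ^ 1)) \<noteq> \<infinity>"
    using SUP_fin[of 1] by (intro nn_integral_noteq_infinite) auto
  then have lim: "AE \<omega> in M. (\<lambda>n. V n \<omega>) \<longlonglongrightarrow> Y \<omega>"
  proof eventually_elim
    case (elim \<omega>)
    then obtain c where c: "c \<ge> 0" "(SUP n. ennreal (V n \<omega>)) = ennreal c"
      by (cases "SUP n. ennreal (V n \<omega>)") auto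
    have "ennreal (V n \<omega>) \<le> ennreal c" for n
      unfolding c(2)[symmetric] by (rule SUP_upper) simp
    then have "V n \<omega> \<le> c" for n
      using c(1) nonneg by (simp add: ennreal_le_iff)
    then have "convergent (\<lambda>n. V n \<omega>)"
      using incseq_convergent[OF mono] convergentI by metis
    then show ?case
      unfolding Y_def by (simp add: convergent_LIMSEQ_iff)
  qed
  show le: "AE \<omega> in M. \<forall>n. V n \<omega> \<le> Y \<omega>"
    using lim by eventually_elim (use incseq_le[OF mono] in auto)
  have Y_power: "integrable M (\<lambda>\<omega>. \<bar>Y \<omega>\<bar> ^ k)" for k
  proof (rule integrableI_bounded)
    have "AE \<omega> in M. ennreal (norm (\<bar>Y \<omega>\<bar> ^ k)) \<le> (SUP n. ennreal (V n \<omega> ^ k))"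
      using lim le
    proof eventually_elim
      case (elim \<omega>)
      have "Y \<omega> \<ge> 0"
        using elim(2) nonneg[of 0 \<omega>] by (meson order_trans)
      have "(\<lambda>n. ennreal (V n \<omega> ^ k)) \<longlonglongrightarrow> ennreal (Y \<omega> ^ k)"
        using elim(1) by (intro tendsto_ennrealI tendsto_power)
      then have "ennreal (Y \<omega> ^ k) \<le> (SUP n. ennreal (V n \<omega> ^ k))"
        by (rule LIMSEQ_le_const2) (auto intro!: SUP_upper)
      then show ?case
        using \<open>Y \<omega> \<ge> 0\<close> by simp
    qed
    then have "(\<integral>\<^sup>+\<omega>. ennreal (norm (\<bar>Y \<omega>\<bar> ^ k)) \<partial>M)
        \<le> (\<integral>\<^sup>+\<omega>. (SUP n. ennreal (V n \<omega> ^ k)) \<partial>M)"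
      by (rule nn_integral_mono_AE)
    then show "(\<integral>\<^sup>+\<omega>. ennreal (norm (\<bar>Y \<omega>\<bar> ^ k)) \<partial>M) < \<infinity>"
      using SUP_fin[of k] le_less_trans by blast
  qed measurable
  show "converges_in_Lp M p V Y" if p: "p > 1" for p
  proof -
    \<comment> \<open>Reduces real exponents to integer ones: the summand 1 covers
      \<open>\<bar>y\<bar> \<le> 1\<close>, and beyond that rounding the exponent up only increases
      the power.\<close>
    have bound: "\<bar>y\<bar> powr p \<le> 1 + \<bar>y\<bar> ^ nat \<lceil>p\<rceil>" for y :: real
    proof (cases "\<bar>y\<bar> \<le> 1")
      case True
      then have "\<bar>y\<bar> powr p \<le> 1"
        using p powr_mono2[of p "\<bar>y\<bar>" 1] by simp
      then show ?thesis
        by (simp add: add_increasing2)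
    next
      case False
      then have "\<bar>y\<bar> powr p \<le> \<bar>y\<bar> powr real (nat \<lceil>p\<rceil>)"
        by (intro powr_mono) (auto simp: real_nat_ceiling_ge)
      then show ?thesis
        using False by (simp add: powr_realpow)
    qed
    have "integrable M (\<lambda>\<omega>. 1 + \<bar>Y \<omega>\<bar> ^ nat \<lceil>p\<rceil>)"
      by (intro Bochner_Integration.integrable_add integrable_const Y_power)
    then have Yp: "integrable M (\<lambda>\<omega>. \<bar>Y \<omega>\<bar> powr p)"
    proof (rule Bochner_Integration.integrable_bound)
      show "AE \<omega> in M. norm (\<bar>Y \<omega>\<bar> powr p) \<le> norm (1 + \<bar>Y \<omega>\<bar> ^ nat \<lceil>p\<rceil>)"
        using bound by (intro AE_I2) (simp add: order_trans[OF _ abs_ge_self])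
    qed measurable
    have Vp: "integrable M (\<lambda>\<omega>. \<bar>V n \<omega>\<bar> powr p)" for n
      using Yp
    proof (rule Bochner_Integration.integrable_bound)
      show "AE \<omega> in M. norm (\<bar>V n \<omega>\<bar> powr p) \<le> norm (\<bar>Y \<omega>\<bar> powr p)"
        using le
      proof eventually_elim
        case (elim \<omega>)
        then have "\<bar>V n \<omega>\<bar> \<le> \<bar>Y \<omega>\<bar>"
          using nonneg[of n \<omega>] by (auto intro: order_trans)
        then show ?case
          using p by (simp add: powr_mono2)
      qed
    qed measurable
    \<comment> \<open>From 0 \<le> \<open>V n \<omega>\<close> \<le> \<open>Y \<omega>\<close> the
      distance to the limit is at most \<open>Y \<omega>\<close>, so
      \<open>\<bar>Y \<omega>\<bar> powr p\<close> serves as the dominating function.\<close>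
    have "(\<lambda>n. LINT \<omega>|M. \<bar>V n \<omega> - Y \<omega>\<bar> powr p) \<longlonglongrightarrow> (LINT \<omega>|M. 0)"
    proof (rule integral_dominated_convergence[OF _ _ Yp])
      show "AE \<omega> in M. (\<lambda>n. \<bar>V n \<omega> - Y \<omega>\<bar> powr p) \<longlonglongrightarrow> 0"
        using lim
      proof eventually_elim
        case (elim \<omega>)
        then have "(\<lambda>n. \<bar>V n \<omega> - Y \<omega>\<bar>) \<longlonglongrightarrow> 0"
          by (simp add: tendsto_rabs_zero_iff LIM_zero)
        then show ?case
          using p by (intro tendsto_zero_powrI[where b=p] tendsto_const) auto
      qed
      show "AE \<omega> in M. norm (\<bar>V n \<omega> - Y \<omega>\<bar> powr p) \<le> \<bar>Y \<omega>\<bar> powr p" for n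
        using le
      proof eventually_elim
        case (elim \<omega>)
        then have "V n \<omega> \<le> Y \<omega>" by simp
        then have "\<bar>V n \<omega> - Y \<omega>\<bar> \<le> \<bar>Y \<omega>\<bar>"
          using nonneg[of n \<omega>] by auto
        then show ?case
          using p by (simp add: powr_mono2)
      qed
    qed measurable
    then have "(\<lambda>n. LINT \<omega>|M. \<bar>V n \<omega> - Y \<omega>\<bar> powr p) \<longlonglongrightarrow> 0"
      by simp
    then have "(\<lambda>n. Lp_norm M p (\<lambda>\<omega>. V n \<omega> - Y \<omega>)) \<longlonglongrightarrow> 0"
      unfolding Lp_norm_def using p
      by (intro tendsto_zero_powrI[where b="1 / p"] tendsto_const) auto
    then show ?thesis
      using Vp Yp by (simp add: converges_in_Lp_def in_Lp_def)
  qed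
qed

section \<open>Estimates for the covariance function\<close>

text \<open>Mean value theorem: for \<open>a \<ge> 1\<close> the derivative a z^(a-1) is
  nondecreasing, hence bounded by its value at \<open>T\<close>. Differentiability is asked only at
  interior points, so an endpoint 0 is admissible.\<close>

lemma powr_diff_le:
  fixes a s t T :: real
  assumes a: "a \<ge> 1" and "0 \<le> s" "s \<le> T" "0 \<le> t" "t \<le> T"
  shows "\<bar>t powr a - s powr a\<bar> \<le> a * T powr (a - 1) * \<bar>t - s\<bar>"
proof -
  have *: "\<bar>t powr a - s powr a\<bar> \<le> a * T powr (a - 1) * \<bar>t - s\<bar>"
    if "0 \<le> s" "s < t" "t \<le> T" for s t
  proof -
    have "\<exists>l z. s < z \<and> z < t \<and> DERIV (\<lambda>x. x powr a) z :> l \<and> t powr a - s powr a = (t - s) * l"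
    proof (rule MVT[OF \<open>s < t\<close>])
      show "continuous_on {s..t} (\<lambda>x. x powr a)"
        using a that by (intro continuous_on_powr' continuous_intros) auto
      show "(\<lambda>x. x powr a) differentiable (at x)" if "s < x" "x < t" for x
        using that \<open>0 \<le> s\<close> has_real_derivative_powr[of x a]
        by (auto simp: real_differentiable_def)
    qed
    then obtain l z where z: "z > s" "z < t" "DERIV (\<lambda>x. x powr a) z :> l"
        "t powr a - s powr a = (t - s) * l"
      by blast
    moreover have "l = a * z powr (a - 1)"
      using z \<open>0 \<le> s\<close> has_real_derivative_powr[of z a] by (intro DERIV_unique) auto
    ultimately have z: "z > s" "z < t" "t powr a - s powr a = (t - s) * (a * z powr (a - 1))"
      by simp_all
    have "z powr (a - 1) \<le> T powr (a - 1)"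
      using z that a by (intro powr_mono2) auto
    then have "(t - s) * (a * z powr (a - 1)) \<le> (t - s) * (a * T powr (a - 1))"
      using that a by (intro mult_left_mono) auto
    moreover have "s powr a \<le> t powr a"
      using that a by (intro powr_mono2) auto
    ultimately show ?thesis
      using z that by (simp add: algebra_simps)
  qed
  show ?thesis
    using *[of s t] *[of t s] assms
    by (cases s t rule: linorder_cases) (auto simp: abs_minus_commute)
qed

text \<open>\<open>H\<close> lies strictly between consecutive integers, so the sine does not vanish
  and the \<open>inverse\<close> in \<open>fbm_const\<close> is a genuine one.\<close>

lemma fbm_const_pos:
  assumes "m \<ge> 1" "real m - 1 < H" "H < real m"
  shows "fbm_const H > 0"
proof -
  have "sin (pi * H) \<noteq> 0"
  proof
    assume "sin (pi * H) = 0"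
    then obtain i :: int where "pi * H = of_int i * pi"
      by (auto simp: sin_zero_iff_int2)
    then have "H = of_int i" by simp
    then have "int m - 1 < i" "i < int m"
      using assms by linarith+
    then show False by simp
  qed
  moreover have "Gamma (2 * H + 1) > 0"
    using assms by (intro Gamma_real_pos) linarith
  ultimately show ?thesis
    by (simp add: fbm_const_def)
qed

text \<open>The summand \<open>j = 0\<close> vanishes; every other summand is a product of two Lipschitz increments.\<close>

lemma fbm_cov_increment:
  "fbm_cov H m t t - 2 * fbm_cov H m s t + fbm_cov H m s s =
    - ((-1) ^ m) * fbm_const H * (\<bar>t - s\<bar> powr (2 * H) +
      (\<Sum>j<m. (-1) ^ j * ((2 * H) gchoose j) *
         ((t ^ j - s ^ j) * (t powr (2 * H - real j) - s powr (2 * H - real j)))))"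
  (is "_ = _ * (_ + (\<Sum>j<m. ?c j * ?d j))")
proof -
  define S where "S s t = (\<Sum>j<m. ?c j * (t ^ j * s powr (2 * H - real j) + s ^ j * t powr (2 * H - real j)))"
    for s t :: real
  have cov: "fbm_cov H m s t = (-1) ^ m * (fbm_const H / 2) * (\<bar>t - s\<bar> powr (2 * H) - S s t)" for s t
    by (simp add: fbm_cov_def S_def)
  \<comment> \<open>Expanding the product leaves two diagonal terms minus the mixed ones;
    \<open>S t t\<close> and \<open>S s s\<close> contain each diagonal term twice, whence the
    halves.\<close>
  have "(\<Sum>j<m. ?c j * ?d j) = (\<Sum>j<m. ?c j * (t ^ j * t powr (2 * H - real j) + t ^ j * t powr (2 * H - real j)) / 2
     + ?c j * (s ^ j * s powr (2 * H - real j) + s ^ j * s powr (2 * H - real j)) / 2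
     - ?c j * (t ^ j * s powr (2 * H - real j) + s ^ j * t powr (2 * H - real j)))"
    by (intro sum.cong refl) (simp add: field_simps)
  also have "\<dots> = S t t / 2 + S s s / 2 - S s t"
    by (simp add: S_def sum.distrib sum_subtractf sum_divide_distrib)
  finally have sum_eq: "(\<Sum>j<m. ?c j * ?d j) = S t t / 2 + S s s / 2 - S s t" .
  show ?thesis
    unfolding cov sum_eq by (simp add: field_simps)
qed

text \<open>Every term of \<open>fbm_cov_increment\<close> is of second order in t - s. As
  \<open>H > 1\<close>, a factor (t - s)^2 splits off from the leading power; for 0 < j < m both
  exponents j and 2H - j are at least 1, so each product has two Lipschitz factors.\<close>

lemma fbm_cov_increment_le:
  assumes "m \<ge> 2" "real m - 1 < H" "H < real m"
  obtains K where "K \<ge> 0" "\<And>s t. 0 \<le> s \<Longrightarrow> s \<le> T \<Longrightarrow> 0 \<le> t \<Longrightarrow> t \<le> T \<Longrightarrow>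
    fbm_cov H m t t - 2 * fbm_cov H m s t + fbm_cov H m s s \<le> K * (t - s)\<^sup>2"
proof
  \<comment> \<open>Product of the Lipschitz constants that \<open>powr_diff_le\<close> gives on
    [0, T] for the exponents j and 2H - j; it is 0 at \<open>j = 0\<close>, matching the vanishing
    summand.\<close>
  define L where "L j = (real j * T powr (real j - 1)) *
      ((2 * H - real j) * T powr (2 * H - real j - 1))" for j
  let ?c = "\<lambda>j. (-1) ^ j * ((2 * H) gchoose j) :: real"
  define K where "K = fbm_const H * (T powr (2 * H - 2) + (\<Sum>j<m. \<bar>?c j\<bar> * L j))"
  have pos: "fbm_const H > 0"
    using assms by (intro fbm_const_pos[of m]) auto
  have L: "L j \<ge> 0" if "j < m" for j
    using that assms by (auto simp: L_def)
  show "K \<ge> 0"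
    using pos L by (auto simp: K_def intro!: mult_nonneg_nonneg add_nonneg_nonneg sum_nonneg)
  fix s t assume st: "0 \<le> s" "s \<le> T" "0 \<le> t" "t \<le> T"
  let ?d = "\<lambda>j. (t ^ j - s ^ j) * (t powr (2 * H - real j) - s powr (2 * H - real j))"
  have d: "\<bar>?d j\<bar> \<le> L j * (t - s)\<^sup>2" if "j < m" for j
  proof (cases "j = 0")
    case False
    have "\<bar>t powr real j - s powr real j\<bar> \<le> real j * T powr (real j - 1) * \<bar>t - s\<bar>"
      using False st by (intro powr_diff_le) auto
    \<comment> \<open>Since \<open>j \<noteq> 0\<close>, real and natural powers agree even at base
      0.\<close>
    then have 1: "\<bar>t ^ j - s ^ j\<bar> \<le> real j * T powr (real j - 1) * \<bar>t - s\<bar>"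
      using False st by (simp add: powr_realpow')
    have 2: "\<bar>t powr (2 * H - real j) - s powr (2 * H - real j)\<bar>
        \<le> (2 * H - real j) * T powr (2 * H - real j - 1) * \<bar>t - s\<bar>"
      using that assms st by (intro powr_diff_le) auto
    have "\<bar>?d j\<bar> \<le> (real j * T powr (real j - 1) * \<bar>t - s\<bar>) *
        ((2 * H - real j) * T powr (2 * H - real j - 1) * \<bar>t - s\<bar>)"
      unfolding abs_mult using 1 2 by (intro mult_mono) auto
    also have "\<dots> = L j * \<bar>t - s\<bar>\<^sup>2"
      by (simp add: L_def power2_eq_square mult_ac)
    finally show ?thesis by simp
  qed (simp add: L_def)
  have "\<bar>t - s\<bar> powr (2 * H) = \<bar>t - s\<bar> powr (2 * H - 2) * (t - s)\<^sup>2"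
  proof (cases "t = s")
    case False
    then have "\<bar>t - s\<bar> powr (2 * H) = \<bar>t - s\<bar> powr (2 * H - 2) * \<bar>t - s\<bar> powr 2"
      by (subst powr_add[symmetric]) simp
    then show ?thesis using False by simp
  qed simp
  also have "\<dots> \<le> T powr (2 * H - 2) * (t - s)\<^sup>2"
    using st assms by (intro mult_right_mono powr_mono2) auto
  finally have 3: "\<bar>t - s\<bar> powr (2 * H) \<le> T powr (2 * H - 2) * (t - s)\<^sup>2" .
  have 4: "\<bar>\<Sum>j<m. ?c j * ?d j\<bar> \<le> (\<Sum>j<m. \<bar>?c j\<bar> * (L j * (t - s)\<^sup>2))"
    using d by (intro order_trans[OF sum_abs] sum_mono) (auto simp: abs_mult intro!: mult_left_mono)
  have "fbm_cov H m t t - 2 * fbm_cov H m s t + fbm_cov H m s s =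
      - ((-1) ^ m) * fbm_const H * (\<bar>t - s\<bar> powr (2 * H) + (\<Sum>j<m. ?c j * ?d j))"
    by (rule fbm_cov_increment)
  \<comment> \<open>Absolute values remove the dependence of the sign on the parity of
    \<open>m\<close>.\<close>
  also have "\<dots> \<le> \<bar>- ((-1) ^ m) * fbm_const H * (\<bar>t - s\<bar> powr (2 * H) + (\<Sum>j<m. ?c j * ?d j))\<bar>"
    by simp
  also have "\<dots> = fbm_const H * \<bar>\<bar>t - s\<bar> powr (2 * H) + (\<Sum>j<m. ?c j * ?d j)\<bar>"
    using pos by (simp add: abs_mult power_abs)
  also have "\<dots> \<le> fbm_const H * (T powr (2 * H - 2) * (t - s)\<^sup>2 + (\<Sum>j<m. \<bar>?c j\<bar> * (L j * (t - s)\<^sup>2)))"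
    using pos 3 4 by (intro mult_left_mono order_trans[OF abs_triangle_ineq] add_mono) auto
  also have "\<dots> = K * (t - s)\<^sup>2"
    by (simp add: K_def algebra_simps sum_distrib_left sum_distrib_right)
  finally show "fbm_cov H m t t - 2 * fbm_cov H m s t + fbm_cov H m s s \<le> K * (t - s)\<^sup>2" .
qed

text \<open>Base 0 kills one half of the sum through \<open>powr\<close> and leaves only
  \<open>j = 0\<close> of the other, which cancels the leading power. Thus \<open>B 0\<close> is
  degenerate and does not affect the variance of \<open>B T - B 0\<close>.\<close>

lemma fbm_cov_zero:
  assumes "m \<ge> 1" "0 \<le> t"
  shows "fbm_cov H m 0 t = 0"
proof -
  have "(\<Sum>j<m. (-1) ^ j * ((2 * H) gchoose j) *
         (t ^ j * 0 powr (2 * H - real j) + 0 ^ j * t powr (2 * H - real j)))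
      = (\<Sum>j<m. if j = 0 then t powr (2 * H) else 0)"
    by (intro sum.cong) auto
  also have "\<dots> = t powr (2 * H)"
    using assms by simp
  finally show ?thesis
    using assms by (simp add: fbm_cov_def)
qed

text \<open>The alternating sum of the first m binomial coefficients of 2H telescopes to (-1)^(m-1)
  times the coefficient of 2H - 1 over m - 1. The signs cancel, and all factors 2H - 1 - i with i <
  m - 1 are positive because \<open>H > m - 1\<close>.\<close>

lemma fbm_cov_diag_pos:
  assumes "m \<ge> 2" "real m - 1 < H" "H < real m" "0 < t"
  shows "fbm_cov H m t t > 0"
proof -
  obtain n where n: "m = Suc n"
    using assms(1) by (cases m) auto
  have prod_pos: "(\<Prod>i = 0..<n. 2 * H - 1 - real i) > 0"
    using assms n by (intro prod_pos) auto
  have gpos: "(2 * H - 1) gchoose n > 0"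
    using prod_pos by (simp add: gbinomial_prod_rev)
  have "(\<Sum>j<m. (-1) ^ j * ((2 * H) gchoose j) *
         (t ^ j * t powr (2 * H - real j) + t ^ j * t powr (2 * H - real j)))
      = (\<Sum>j<m. ((2 * H) gchoose j) * (-1) ^ j * (2 * t powr (2 * H)))"
  proof (intro sum.cong refl)
    fix j
    have "t ^ j * t powr (2 * H - real j) = t powr (2 * H)"
      using assms by (simp add: powr_diff powr_realpow)
    then show "(-1) ^ j * ((2 * H) gchoose j) *
         (t ^ j * t powr (2 * H - real j) + t ^ j * t powr (2 * H - real j))
      = ((2 * H) gchoose j) * (-1) ^ j * (2 * t powr (2 * H))"
      by simp
  qed
  also have "\<dots> = (-1) ^ n * ((2 * H - 1) gchoose n) * (2 * t powr (2 * H))"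
    unfolding n lessThan_Suc_atMost sum_distrib_right[symmetric] gbinomial_sum_lower_neg ..
  finally have "fbm_cov H m t t = (-1) ^ m * (fbm_const H / 2) *
      (0 - (-1) ^ n * ((2 * H - 1) gchoose n) * (2 * t powr (2 * H)))"
    by (simp add: fbm_cov_def)
  also have "\<dots> = fbm_const H * ((2 * H - 1) gchoose n) * t powr (2 * H)"
    by (simp add: n mult_ac flip: power_add mult_2 power_mult_distrib)
  finally show ?thesis
    using gpos assms fbm_const_pos[of m H] by simp
qed

section \<open>Gaussian processes and the variance of increments\<close>

lemma gaussian_process_lincomb:
  assumes "gaussian_process M I X" "finite J" "J \<subseteq> I"
  shows "gaussian_rv M (\<lambda>\<omega>. \<Sum>t\<in>J. a t * X t \<omega>)"
  using assms by (simp add: gaussian_process_def)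

lemma gaussian_process_component:
  assumes "gaussian_process M I X" "t \<in> I"
  shows "gaussian_rv M (X t)"
  using gaussian_process_lincomb[OF assms(1), of "{t}" "\<lambda>_. 1"] assms(2) by simp

lemma gaussian_process_increment:
  assumes "gaussian_process M I X" "s \<in> I" "t \<in> I"
  shows "gaussian_rv M (\<lambda>\<omega>. X t \<omega> - X s \<omega>)"
proof (cases "s = t")
  \<comment> \<open>For equal times the index set \<open>{t, s}\<close> collapses to one point and
    the coefficients would yield \<open>X t\<close>; the empty combination gives the required
    0.\<close>
  case True
  with gaussian_process_lincomb[OF assms(1), of "{}"] show ?thesis by simp
next
  case False
  with gaussian_process_lincomb[OF assms(1), of "{t, s}" "\<lambda>u. if u = t then 1 else -1"] assms(2,3)
  show ?thesis by simp
qed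

lemma
  assumes B: "fractional_brownian_motion M H m B" and st: "0 \<le> s" "0 \<le> t"
  shows fbm_increment_mean: "(LINT \<omega>|M. B t \<omega> - B s \<omega>) = 0"
    and fbm_increment_var: "(LINT \<omega>|M. (B t \<omega> - B s \<omega>)\<^sup>2) =
      fbm_cov H m t t - 2 * fbm_cov H m s t + fbm_cov H m s s"
proof -
  have G: "gaussian_process M {0..} B" and mean: "\<And>t. t \<ge> 0 \<Longrightarrow> integral\<^sup>L M (B t) = 0"
    and cov: "\<And>s t. s \<ge> 0 \<Longrightarrow> t \<ge> 0 \<Longrightarrow> (LINT \<omega>|M. B s \<omega> * B t \<omega>) = fbm_cov H m s t"
    using B by (auto simp: fractional_brownian_motion_def covariance_def)
  have P: "prob_space M"
    using G by (simp add: gaussian_process_def)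
  have Gt: "gaussian_rv M (B t)" if "t \<ge> 0" for t
    using gaussian_process_component[OF G] that by simp
  have Gd: "gaussian_rv M (\<lambda>\<omega>. B t \<omega> - B s \<omega>)"
    using gaussian_process_increment[OF G] st by simp
  show mean_d: "(LINT \<omega>|M. B t \<omega> - B s \<omega>) = 0"
    using gaussian_rv_integrable[OF P Gt] mean st by simp
  have sq: "integrable M (\<lambda>\<omega>. (X \<omega>)\<^sup>2)" if "gaussian_rv M X" "integral\<^sup>L M X = 0" for X
    using centered_gaussian_moment[OF P that, of 1] by (auto intro: integrable.intros)
  \<comment> \<open>Polarisation: integrability of the mixed product follows from that of three
    squares of centered Gaussian variables, one of them the increment.\<close>
  have "integrable M (\<lambda>\<omega>. ((B s \<omega>)\<^sup>2 + (B t \<omega>)\<^sup>2 - (B t \<omega> - B s \<omega>)\<^sup>2) / 2)"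
    using sq[OF Gt[OF st(1)] mean[OF st(1)]] sq[OF Gt[OF st(2)] mean[OF st(2)]] sq[OF Gd mean_d]
    by auto
  then have prod: "integrable M (\<lambda>\<omega>. B s \<omega> * B t \<omega>)"
    by (rule back_subst[where P="integrable M"]) (auto simp: fun_eq_iff power2_eq_square field_simps)
  have "(LINT \<omega>|M. (B t \<omega> - B s \<omega>)\<^sup>2) =
      (LINT \<omega>|M. (B t \<omega>)\<^sup>2 - 2 * (B s \<omega> * B t \<omega>) + (B s \<omega>)\<^sup>2)"
    by (intro Bochner_Integration.integral_cong) (auto simp: power2_eq_square algebra_simps)
  also have "\<dots> = (LINT \<omega>|M. (B t \<omega>)\<^sup>2) - 2 * (LINT \<omega>|M. B s \<omega> * B t \<omega>) + (LINT \<omega>|M. (B s \<omega>)\<^sup>2)"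
    using sq[OF Gt[OF st(1)] mean[OF st(1)]] sq[OF Gt[OF st(2)] mean[OF st(2)]] prod by simp
  finally show "(LINT \<omega>|M. (B t \<omega> - B s \<omega>)\<^sup>2) =
      fbm_cov H m t t - 2 * fbm_cov H m s t + fbm_cov H m s s"
    using cov st by (simp add: power2_eq_square)
qed

section \<open>Dyadic squared variation: monotonicity and moments\<close>

text \<open>Formulated for a single path, since monotonicity is a pathwise fact. Counting from 0
  makes halving the mesh split the increment k into those numbered 2k and 2k + 1.\<close>

definition dyadic_sq_variation :: "(real \<Rightarrow> real) \<Rightarrow> real \<Rightarrow> nat \<Rightarrow> real" where
  "dyadic_sq_variation f T n = 2 ^ n * (\<Sum>k<(2::nat) ^ n.
     (f (real (Suc k) * T / 2 ^ n) - f (real k * T / 2 ^ n))\<^sup>2)"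

text \<open>Each coarse increment is the sum of two fine ones; the factor 2 lost in squaring that
  sum is exactly the growth of the weight from \<open>2 ^ n\<close> to
  \<open>2 ^ Suc n\<close>.\<close>

lemma incseq_dyadic_sq_variation: "incseq (dyadic_sq_variation f T)"
proof (rule incseq_SucI)
  fix n
  let ?g = "\<lambda>k. f (real k * T / 2 ^ Suc n)"
  have halves: "(\<Sum>k<2 * N. h k) = (\<Sum>k<N. h (2 * k) + h (Suc (2 * k)))" for N and h :: "nat \<Rightarrow> real"
    by (induction N) auto
  have g: "f (real k * T / 2 ^ n) = ?g (2 * k)" for k
    by simp
  \<comment> \<open>The right side exceeds the left by the square of the second difference
    \<open>a - 2 * b + c\<close>.\<close>
  have sq: "(a - c)\<^sup>2 \<le> 2 * ((b - c)\<^sup>2 + (a - b)\<^sup>2)" for a b c :: real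
    using zero_le_power2[of "a - 2 * b + c"] by (simp add: power2_eq_square algebra_simps)
  have "dyadic_sq_variation f T n = 2 ^ n * (\<Sum>k<2 ^ n. (?g (2 * Suc k) - ?g (2 * k))\<^sup>2)"
    unfolding dyadic_sq_variation_def g ..
  also have "\<dots> \<le> 2 ^ n * (\<Sum>k<2 ^ n. 2 * ((?g (Suc (2 * k)) - ?g (2 * k))\<^sup>2 +
      (?g (2 * Suc k) - ?g (Suc (2 * k)))\<^sup>2))"
    by (intro mult_left_mono sum_mono sq) auto
  also have "\<dots> = 2 ^ Suc n * (\<Sum>k<2 * 2 ^ n. (?g (Suc k) - ?g k)\<^sup>2)"
    unfolding halves sum_distrib_left[symmetric] by simp
  also have "\<dots> = dyadic_sq_variation f T (Suc n)"
    by (simp add: dyadic_sq_variation_def)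
  finally show "dyadic_sq_variation f T n \<le> dyadic_sq_variation f T (Suc n)" .
qed

text \<open>With N = \<open>2 ^ n\<close>, the variation is the average of the N squares of the
  rescaled increments \<open>N * D k\<close>. Their variances are at most
  \<open>K * T\<^sup>2\<close> for every n, so Jensen's inequality and the Gaussian moment formula
  give a bound free of n.\<close>

lemma fbm_dyadic_moment_bound:
  assumes m: "m \<ge> 2" and B: "fractional_brownian_motion M H m B" and T: "0 < T"
  shows "\<exists>K. \<forall>n. (\<integral>\<^sup>+\<omega>. ennreal (dyadic_sq_variation (\<lambda>t. B t \<omega>) T n ^ q) \<partial>M) \<le> ennreal K"
proof -
  have H: "real m - 1 < H" "H < real m" and G: "gaussian_process M {0..} B"
    using B by (auto simp: fractional_brownian_motion_def)
  have P: "prob_space M"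
    using G by (simp add: gaussian_process_def)
  obtain K where K: "K \<ge> 0" "\<And>s t. 0 \<le> s \<Longrightarrow> s \<le> T \<Longrightarrow> 0 \<le> t \<Longrightarrow> t \<le> T \<Longrightarrow>
    fbm_cov H m t t - 2 * fbm_cov H m s t + fbm_cov H m s s \<le> K * (t - s)\<^sup>2"
    using fbm_cov_increment_le[OF m H] by blast
  \<comment> \<open>The moment of order 2q of a centered normal variable with variance
    \<open>K * T\<^sup>2\<close>.\<close>
  define C where "C = fact (2 * q) / (2 ^ q * fact q) * (K * T\<^sup>2) ^ q"
  have "(\<integral>\<^sup>+\<omega>. ennreal (dyadic_sq_variation (\<lambda>t. B t \<omega>) T n ^ q) \<partial>M) \<le> ennreal C" for n
  proof -
    define N where "N = (2::nat) ^ n"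
    have N: "N > 0" "(2::real) ^ n = real N"
      by (simp_all add: N_def)
    define D where "D k \<omega> = B (real (Suc k) * T / N) \<omega> - B (real k * T / N) \<omega>" for k \<omega>
    have D: "has_bochner_integral M (\<lambda>\<omega>. D k \<omega> ^ (2 * q))
           (fact (2 * q) / (2 ^ q * fact q) * (LINT \<omega>|M. (D k \<omega>)\<^sup>2) ^ q)"
      "(LINT \<omega>|M. (D k \<omega>)\<^sup>2) \<le> K * T\<^sup>2 / real N ^ 2" if "k < N" for k
    proof -
      have nn: "0 \<le> real k * T / N" "0 \<le> real (Suc k) * T / N"
        using T by auto
      show "has_bochner_integral M (\<lambda>\<omega>. D k \<omega> ^ (2 * q))
           (fact (2 * q) / (2 ^ q * fact q) * (LINT \<omega>|M. (D k \<omega>)\<^sup>2) ^ q)"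
        unfolding D_def
        using nn by (intro centered_gaussian_moment P gaussian_process_increment[OF G]
            fbm_increment_mean[OF B]) auto
      have le: "real k * T / N \<le> T" "real (Suc k) * T / N \<le> T"
      proof -
        have "real k \<le> real N" "real (Suc k) \<le> real N"
          using that by linarith+
        from this[THEN mult_right_mono, of T] show "real k * T / N \<le> T" "real (Suc k) * T / N \<le> T"
          using T N by (simp_all add: pos_divide_le_eq mult.commute)
      qed
      have "(LINT \<omega>|M. (D k \<omega>)\<^sup>2) \<le> K * (real (Suc k) * T / N - real k * T / N)\<^sup>2"
        unfolding D_def fbm_increment_var[OF B nn] by (intro K nn le)
      also have "real (Suc k) * T / N - real k * T / N = T / N"
        by (simp add: distrib_right add_divide_distrib)
      finally show "(LINT \<omega>|M. (D k \<omega>)\<^sup>2) \<le> K * T\<^sup>2 / real N ^ 2"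
        by (simp add: power_divide)
    qed
    have bound: "(LINT \<omega>|M. (real N ^ 2) ^ q * D k \<omega> ^ (2 * q)) \<le> C" if "k < N" for k
    proof -
      have "(real N ^ 2) ^ q * (LINT \<omega>|M. (D k \<omega>)\<^sup>2) ^ q = (real N ^ 2 * (LINT \<omega>|M. (D k \<omega>)\<^sup>2)) ^ q"
        by (simp add: power_mult_distrib)
      also have "\<dots> \<le> (K * T\<^sup>2) ^ q"
        using D(2)[OF that] N by (intro power_mono) (auto simp: field_simps)
      finally have "fact (2 * q) / (2 ^ q * fact q) * ((real N ^ 2) ^ q * (LINT \<omega>|M. (D k \<omega>)\<^sup>2) ^ q) \<le> C"
        unfolding C_def by (intro mult_left_mono) auto
      then show ?thesis
        using has_bochner_integral_integral_eq[OF D(1)[OF that]] by (simp add: mult_ac)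
    qed
    have int: "integrable M (\<lambda>\<omega>. (real N ^ 2) ^ q * D k \<omega> ^ (2 * q))" if "k < N" for k
      using integrable.intros[OF D(1)[OF that]] by simp
    have pw: "dyadic_sq_variation (\<lambda>t. B t \<omega>) T n ^ q
        \<le> (\<Sum>k<N. (real N ^ 2) ^ q * D k \<omega> ^ (2 * q)) / N" for \<omega>
    proof -
      \<comment> \<open>The weight N is written as N^2 / N, turning the weighted sum into an
        average.\<close>
      have "dyadic_sq_variation (\<lambda>t. B t \<omega>) T n = (\<Sum>k<N. real N ^ 2 * (D k \<omega>)\<^sup>2) / N"
        unfolding dyadic_sq_variation_def N_def[symmetric] N(2) D_def sum_distrib_left[symmetric]
        using N(1) by (simp add: power2_eq_square)
      also have "\<dots> ^ q \<le> (\<Sum>k<N. (real N ^ 2 * (D k \<omega>)\<^sup>2) ^ q) / N"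
        using N(1) by (intro power_average_le) auto
      finally show ?thesis
        by (simp add: power_mult_distrib power_mult)
    qed
    have "(\<integral>\<^sup>+\<omega>. ennreal (dyadic_sq_variation (\<lambda>t. B t \<omega>) T n ^ q) \<partial>M)
        \<le> (\<integral>\<^sup>+\<omega>. ennreal ((\<Sum>k<N. (real N ^ 2) ^ q * D k \<omega> ^ (2 * q)) / N) \<partial>M)"
      by (intro nn_integral_mono ennreal_leI pw)
    also have "\<dots> = ennreal (LINT \<omega>|M. (\<Sum>k<N. (real N ^ 2) ^ q * D k \<omega> ^ (2 * q)) / N)"
      by (intro nn_integral_eq_integral integrable_divide_zero Bochner_Integration.integrable_sum int AE_I2
          divide_nonneg_nonneg sum_nonneg mult_nonneg_nonneg) auto
    also have "(LINT \<omega>|M. (\<Sum>k<N. (real N ^ 2) ^ q * D k \<omega> ^ (2 * q)) / N) =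
        (\<Sum>k<N. LINT \<omega>|M. (real N ^ 2) ^ q * D k \<omega> ^ (2 * q)) / N"
      using int by (subst integral_divide_zero, subst Bochner_Integration.integral_sum)
        (auto simp del: integral_mult_right_zero)
    also have "\<dots> \<le> (\<Sum>k<N. C) / N"
      using bound by (intro divide_right_mono sum_mono) auto
    also have "\<dots> = C"
      using N(1) by simp
    finally show ?thesis
      by (simp add: ennreal_leI)
  qed
  then show ?thesis by blast
qed

section \<open>Existence and non-constancy of the limit\<close>

theorem theorem2p5:
  fixes M :: "'a measure" and B :: "real \<Rightarrow> 'a \<Rightarrow> real"
    and m :: nat and H T :: real
  assumes "m \<ge> 2"
    and "real m - 1 < H" and "H < real m"
    and "0 < T"
    and "fractional_brownian_motion M H m B"
  shows "\<exists>Y. nonconstant_rv M Y \<and>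
    (\<forall>p>1. converges_in_Lp M p
       (\<lambda>n \<omega>. 2 ^ n * (\<Sum>k = 1..(2::nat) ^ n.
          (B (real k * T / 2 ^ n) \<omega> - B ((real k - 1) * T / 2 ^ n) \<omega>)\<^sup>2))
       Y)"
proof -
  note B = assms(5)
  have G: "gaussian_process M {0..} B"
    using B by (auto simp: fractional_brownian_motion_def)
  have P: "prob_space M" and meas [measurable]: "\<And>t. t \<ge> 0 \<Longrightarrow> B t \<in> borel_measurable M"
    using G by (auto simp: gaussian_process_def)
  define V where "V n \<omega> = dyadic_sq_variation (\<lambda>t. B t \<omega>) T n" for n \<omega>
  \<comment> \<open>Shifts the summation index from 1, ..., 2^n to 0, ..., 2^n - 1.\<close>
  have V_eq: "(\<lambda>n \<omega>. 2 ^ n * (\<Sum>k = 1..(2::nat) ^ n.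
          (B (real k * T / 2 ^ n) \<omega> - B ((real k - 1) * T / 2 ^ n) \<omega>)\<^sup>2)) = V"
    unfolding V_def dyadic_sq_variation_def
    by (simp add: fun_eq_iff sum.atLeast1_atMost_eq)
  have V_meas: "V n \<in> borel_measurable M" for n
    unfolding V_def dyadic_sq_variation_def
    using assms(4) by (intro borel_measurable_times borel_measurable_const borel_measurable_sum
        borel_measurable_power borel_measurable_diff meas) auto
  have V_nonneg: "V n \<omega> \<ge> 0" for n \<omega>
    by (auto simp: V_def dyadic_sq_variation_def intro!: mult_nonneg_nonneg sum_nonneg)
  have V_mono: "incseq (\<lambda>n. V n \<omega>)" for \<omega>
    unfolding V_def by (rule incseq_dyadic_sq_variation)
  have V_bdd: "\<exists>K. \<forall>n. (\<integral>\<^sup>+\<omega>. ennreal (V n \<omega> ^ q) \<partial>M) \<le> ennreal K" for q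
    unfolding V_def by (rule fbm_dyadic_moment_bound[OF assms(1) B assms(4)])
  obtain Y where Y: "Y \<in> borel_measurable M" "AE \<omega> in M. \<forall>n. V n \<omega> \<le> Y \<omega>"
    "\<And>p. p > 1 \<Longrightarrow> converges_in_Lp M p V Y"
    using incseq_converges_in_Lp[of M V, OF P V_meas V_nonneg V_mono V_bdd] by blast
  have "\<not> (AE \<omega> in M. Y \<omega> = c)" for c
  proof
    assume "AE \<omega> in M. Y \<omega> = c"
    \<comment> \<open>At \<open>n = 0\<close> the variation is the single square
      \<open>(B T \<omega> - B 0 \<omega>)\<^sup>2\<close>, so a constant limit would bound a
      nondegenerate Gaussian variable.\<close>
    with Y(2) have bdd: "AE \<omega> in M. (B T \<omega> - B 0 \<omega>)\<^sup>2 \<le> c"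
    proof eventually_elim
      case (elim \<omega>)
      then have "V 0 \<omega> \<le> c" by blast
      then show ?case by (simp add: V_def dyadic_sq_variation_def)
    qed
    have "(LINT \<omega>|M. (B T \<omega> - B 0 \<omega>)\<^sup>2) = fbm_cov H m T T"
      using assms fbm_increment_var[OF B, of 0 T] fbm_cov_zero[of m] by simp
    also have "\<dots> \<noteq> 0"
      using fbm_cov_diag_pos[OF assms(1-4)] by simp
    finally show False
      using centered_gaussian_unbounded[OF P gaussian_process_increment[OF G]
          fbm_increment_mean[OF B]] bdd assms(4) by auto
  qed
  then show ?thesis
    unfolding V_eq nonconstant_rv_def using Y by blast
qed

end
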